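(* Let $A\in\mathbb{C}^{n\times n}$ have index $k$ and satisfy $\operatorname{rank}(A^{\sim}AA^{\sim})=\operatorname{rank}(A)$, and let $X\in\mathbb{C}^{n\times n}$. Then the following statements are equivalent: (1) $X=A^{D,\mathfrak{m}}$; (2) $AX^{2}=X$ and $AX=A^{2}A^{D}A^{\mathfrak{m}}$; (3) $AX^{2}=X$ and $AX=P_{\mathcal{R}(A^{k}),\mathcal{N}(A^{D}A^{\mathfrak{m}})}$; (4) $AX^{2}=X$ and $A^{k}X=A^{k}A^{\mathfrak{m}}$.
   Context: $\mathcal{R}(\cdot)$ and $\mathcal{N}(\cdot)$ denote range and null space. For subspaces with $\mathcal{S}\oplus\mathcal{T}=\mathbb{C}^n$, $P_{\mathcal{S},\mathcal{T}}$ is the projector onto $\mathcal{S}$ along $\mathcal{T}$. The index of $A\in\mathbb{C}^{n\times n}$ is the smallest nonnegative integer $k$ with $\operatorname{rank}(A^{k+1})=\operatorname{rank}(A^{k})$. The Minkowski metric matrix of order $n$ is $G=\operatorname{diag}(1,-I_{n-1})$. For $A\in\mathbb{C}^{n\times n}$, the Minkowski adjoint is $A^{\sim}=GA^{*}G$, where $A^*$ is the conjugate transpose. The Drazin inverse $A^{D}$ of $A$ (of index $k$) is the unique $X$ with $XAX=X$, $AX=XA$, $A^{k+1}X=A^{k}$. The Minkowski inverse $A^{\mathfrak{m}}$ is the unique matrix $X$ (if it exists) with $AXA=A$, $XAX=X$, $(AX)^{\sim}=AX$, $(XA)^{\sim}=XA$; it exists if and only if $\operatorname{rank}(A^{\sim}AA^{\sim})=\operatorname{rank}(A)$.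 When it exists, the $\mathfrak{m}$-DMP inverse of $A$ is $A^{D,\mathfrak{m}}=A^{D}AA^{\mathfrak{m}}$. *)

theory Defs
  imports
    "Jordan_Normal_Form.Matrix_Kernel"
    "Jordan_Normal_Form.DL_Rank"
    "Jordan_Normal_Form.Schur_Decomposition"
begin

text \<open>
  Square complex matrices of order n are elements of \<open>carrier_mat n n\<close>. Rank, range, null space and
  conjugate transpose are \<open>vec_space.rank n\<close>, \<open>vec_space.col_space n\<close>, \<open>mat_kernel\<close> and
  \<open>mat_adjoint\<close>; the argument n of the first two is the number of rows.
\<close>

definition complementary_subspaces :: "nat \<Rightarrow> complex vec set \<Rightarrow> complex vec set \<Rightarrow> bool" where
  "complementary_subspaces n S T \<longleftrightarrow>
     VectorSpace.subspace class_ring S (module_vec TYPE(complex) n) \<and>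
     VectorSpace.subspace class_ring T (module_vec TYPE(complex) n) \<and>
     S \<inter> T = {0\<^sub>v n} \<and>
     {s + t | s t. s \<in> S \<and> t \<in> T} = carrier_vec n"

text \<open>The following is meaningful only if \<open>complementary_subspaces n S T\<close> holds; the matrix is then
  unique.\<close>

definition projector :: "nat \<Rightarrow> complex vec set \<Rightarrow> complex vec set \<Rightarrow> complex mat" where
  "projector n S T =
     (THE P. P \<in> carrier_mat n n \<and> (\<forall>s\<in>S. P *\<^sub>v s = s) \<and> (\<forall>t\<in>T. P *\<^sub>v t = 0\<^sub>v n))"

definition mat_index :: "complex mat \<Rightarrow> nat" where
  "mat_index A =
     (LEAST k. vec_space.rank (dim_row A) (A ^\<^sub>m (k + 1)) = vec_space.rank (dim_row A) (A ^\<^sub>m k))"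

definition minkowski_metric :: "nat \<Rightarrow> complex mat" where
  "minkowski_metric n =
     mat n n (\<lambda>(i, j). if i = j then (if i = 0 then 1 else - 1) else 0)"

definition minkowski_adjoint :: "complex mat \<Rightarrow> complex mat" where
  "minkowski_adjoint A =
     minkowski_metric (dim_row A) * mat_adjoint A * minkowski_metric (dim_row A)"

definition drazin_inverse :: "complex mat \<Rightarrow> complex mat" where
  "drazin_inverse A =
     (THE X. X \<in> carrier_mat (dim_row A) (dim_row A) \<and>
        X * A * X = X \<and>
        A * X = X * A \<and>
        A ^\<^sub>m (mat_index A + 1) * X = A ^\<^sub>m mat_index A)"

text \<open>The Minkowski inverse need not exist: the next two definitions are meaningful only for square A
  with rank of \<open>minkowski_adjoint A * A * minkowski_adjoint A\<close> equal to the rank of A.\<close>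

definition minkowski_inverse :: "complex mat \<Rightarrow> complex mat" where
  "minkowski_inverse A =
     (THE X. X \<in> carrier_mat (dim_row A) (dim_row A) \<and>
        A * X * A = A \<and>
        X * A * X = X \<and>
        minkowski_adjoint (A * X) = A * X \<and>
        minkowski_adjoint (X * A) = X * A)"

definition m_DMP_inverse :: "complex mat \<Rightarrow> complex mat" where
  "m_DMP_inverse A = drazin_inverse A * A * minkowski_inverse A"

end

theory Submission
  imports Defs
begin

text \<open>
  The equivalences are monoid identities. Let \<open>d\<close> be the Drazin inverse of \<open>a\<close> and \<open>m\<close> any
  element with \<open>a m a = a\<close>. The idempotent \<open>e = a d = d a\<close> equals both
  \<open>a\<^sup>j d\<^sup>j\<close> and \<open>d\<^sup>j a\<^sup>j\<close> for all \<open>j \<ge> 1\<close> and satisfies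
  \<open>e a\<^sup>k = a\<^sup>k = a\<^sup>k e\<close>. Iterating \<open>a x\<^sup>2 = x\<close> gives \<open>x = a\<^sup>k x\<^sup>k\<^sup>+\<^sup>1\<close>, hence
  \<open>e x = x\<close>. So \<open>x\<close> is recovered from \<open>a x\<close> as \<open>d (a x)\<close>, and from \<open>a\<^sup>k x\<close> as
  \<open>d\<^sup>k\<^sup>+\<^sup>1 a (a\<^sup>k x)\<close>; putting in \<open>a\<^sup>2 d m\<close> or \<open>a\<^sup>k m\<close> yields \<open>d a m\<close>. Conversely \<open>d a m\<close>
  satisfies all the equations because \<open>a m e = e\<close>.

  For the description by a projector, \<open>p = a\<^sup>2 d m\<close> is idempotent, and \<open>p\<close> and \<open>a\<^sup>k\<close> are right multiples
  of each other while \<open>p\<close> and \<open>d m\<close> are left multiples of each other. For matrices this says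
  that \<open>p\<close> has the range of \<open>a\<^sup>k\<close> and the null space of \<open>d m\<close>; an idempotent
  matrix is the projector onto its range along its null space.

  What remains is that the two generalised inverses exist, since they are defined by description. If
  \<open>rank (B C) = rank B\<close>, then \<open>B C\<close> and \<open>B\<close> have the same range, so \<open>B = B C Y\<close> can be solved for \<open>Y\<close>.
  Rank-nullity together with \<open>N(B\<^sup>*B) = N(B)\<close> shows that the adjoint preserves rank, and
  taking adjoints then solves \<open>B = Z C B\<close> for \<open>Z\<close> whenever \<open>rank (C B) = rank B\<close>.
  With these factors the inverses are given by formulas: \<open>A\<^sup>k Y\<^sup>k\<^sup>+\<^sup>1\<close> is the Drazin inverse, where
  \<open>A\<^sup>k = A\<^sup>k\<^sup>+\<^sup>1 Y = Z A\<^sup>k\<^sup>+\<^sup>1\<close>, and \<open>B Y\<close> is the Minkowski inverse, where \<open>B\<close> is the Minkowski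
  adjoint of \<open>A\<close> and \<open>B = B A B Y = Z B A B\<close>. The Minkowski inverse is the Moore-Penrose
  inverse for the involution given by the Minkowski adjoint. The form behind this involution is
  indefinite for \<open>n \<ge> 2\<close>, so \<open>B A\<close> may have smaller rank than \<open>A\<close>; the rank hypothesis on \<open>B A B\<close> is what makes the
  two factorisations available.
\<close>

section \<open>Drazin inverses in a monoid\<close>

context monoid
begin

definition is_drazin :: "'a \<Rightarrow> nat \<Rightarrow> 'a \<Rightarrow> bool" where
  "is_drazin a k x \<longleftrightarrow>
     x \<in> carrier G \<and> x \<otimes> a \<otimes> x = x \<and> a \<otimes> x = x \<otimes> a \<and> a [^] (k + 1) \<otimes> x = a [^] k"

lemma is_drazinD:
  assumes "is_drazin a k x"
  shows "x \<in> carrier G" "x \<otimes> a \<otimes> x = x" "a \<otimes> x = x \<otimes> a" "a [^] (k + 1) \<otimes> x = a [^] k"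
  using assms by (auto simp: is_drazin_def)

lemma pow_absorb_right:
  assumes a: "a \<in> carrier G" and y: "y \<in> carrier G" and eq: "a [^] (k + 1) \<otimes> y = a [^] k"
  shows "a [^] (k + j) \<otimes> y [^] j = a [^] (k::nat)"
proof (induction j)
  case 0
  then show ?case using a by simp
next
  case (Suc j)
  have "a [^] (k + Suc j) \<otimes> y [^] Suc j = a [^] (j + (k + 1)) \<otimes> (y \<otimes> y [^] j)"
    using y by (simp add: add_ac nat_pow_comm[of y 1 j, simplified])
  also have "\<dots> = a [^] j \<otimes> (a [^] (k + 1) \<otimes> y) \<otimes> y [^] j"
    using a y by (simp only: nat_pow_mult[symmetric] m_assoc nat_pow_closed m_closed)
  also have "\<dots> = a [^] (k + j) \<otimes> y [^] j"
    unfolding eq using a by (simp add: nat_pow_mult add.commute)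
  also have "\<dots> = a [^] k" by (rule Suc.IH)
  finally show ?case .
qed

lemma pow_absorb_left:
  assumes a: "a \<in> carrier G" and z: "z \<in> carrier G" and eq: "z \<otimes> a [^] (k + 1) = a [^] k"
  shows "z [^] j \<otimes> a [^] (k + j) = a [^] (k::nat)"
proof (induction j)
  case 0
  then show ?case using a by simp
next
  case (Suc j)
  have "z [^] Suc j \<otimes> a [^] (k + Suc j) = z [^] j \<otimes> z \<otimes> a [^] ((k + 1) + j)"
    by (simp add: add_ac)
  also have "\<dots> = z [^] j \<otimes> ((z \<otimes> a [^] (k + 1)) \<otimes> a [^] j)"
    using a z by (simp only: nat_pow_mult[symmetric] m_assoc nat_pow_closed m_closed)
  also have "\<dots> = z [^] j \<otimes> a [^] (k + j)"
    unfolding eq using a by (simp add: nat_pow_mult)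
  also have "\<dots> = a [^] k" by (rule Suc.IH)
  finally show ?case .
qed

text \<open>The two hypotheses express stability of the range and of the null space of \<open>a\<^sup>k\<close>. The two candidates
  \<open>a\<^sup>k y\<^sup>k\<^sup>+\<^sup>1\<close> and \<open>z\<^sup>k\<^sup>+\<^sup>1 a\<^sup>k\<close> coincide; each form supplies one half of the commutation
  \<open>a x = x a\<close>.\<close>

lemma drazin_exists:
  assumes a: "a \<in> carrier G" and y: "y \<in> carrier G" and z: "z \<in> carrier G"
    and ay: "a [^] (k + 1) \<otimes> y = a [^] k" and za: "z \<otimes> a [^] (k + 1) = a [^] (k::nat)"
  shows "is_drazin a k (a [^] k \<otimes> y [^] (k + 1))"
proof -
  note R = pow_absorb_right[OF a y ay] and L = pow_absorb_left[OF a z za]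
  note cl = a y z m_closed nat_pow_closed
  have swap: "a [^] k \<otimes> y [^] j = z [^] j \<otimes> a [^] k" for j :: nat
  proof -
    have "a [^] k \<otimes> y [^] j = z [^] j \<otimes> a [^] (k + j) \<otimes> y [^] j" by (simp only: L)
    also have "\<dots> = z [^] j \<otimes> a [^] k" using cl by (simp add: m_assoc R)
    finally show ?thesis .
  qed
  define x where "x = a [^] k \<otimes> y [^] (k + 1)"
  have xz: "x = z [^] (k + 1) \<otimes> a [^] k" unfolding x_def by (rule swap)
  have x: "x \<in> carrier G" using cl by (simp add: x_def)
  have ax: "a \<otimes> x = a [^] k \<otimes> y [^] k"
  proof -
    have "a \<otimes> x = (a \<otimes> a [^] k) \<otimes> (y \<otimes> y [^] k)"
      unfolding x_def using cl nat_pow_comm[of y 1 k] by (simp add: m_assoc)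
    also have "\<dots> = a [^] (k + 1) \<otimes> y \<otimes> y [^] k"
      using cl nat_pow_comm[of a 1 k] by (simp add: m_assoc)
    finally show ?thesis by (simp only: ay)
  qed
  have xa: "x \<otimes> a = a [^] k \<otimes> y [^] k"
  proof -
    have "x \<otimes> a = z [^] k \<otimes> (z \<otimes> a [^] (k + 1))"
      unfolding xz using cl by (simp add: m_assoc)
    then show ?thesis by (simp only: za swap)
  qed
  have comm: "a \<otimes> x = x \<otimes> a" by (simp only: ax xa)
  have "x \<otimes> a \<otimes> x = x \<otimes> (a [^] k \<otimes> y [^] k)" using cl x by (simp add: m_assoc ax)
  also have "\<dots> = z [^] (k + 1) \<otimes> (a [^] (k + k) \<otimes> y [^] k)"
    unfolding xz using cl by (simp add: m_assoc nat_pow_mult[symmetric])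
  also have "\<dots> = x" by (simp only: R xz)
  finally have outer: "x \<otimes> a \<otimes> x = x" .
  have "a [^] (k + 1) \<otimes> x = a [^] (k + (k + 1)) \<otimes> y [^] (k + 1)"
    unfolding x_def using cl
    by (simp only: m_assoc[symmetric] nat_pow_mult) (simp add: add_ac)
  then have "a [^] (k + 1) \<otimes> x = a [^] k" by (simp only: R)
  with x comm outer show ?thesis by (simp add: is_drazin_def x_def)
qed

text \<open>Since \<open>a\<close> and \<open>x\<close> commute, powers of the idempotent \<open>e = a x\<close> are products of powers, so \<open>e\<close> can be
  traded for arbitrarily high powers of \<open>a\<close>. In the last two parts \<open>e\<close> acts as the
  identity on \<open>a\<^sup>k\<close>: it is the projection onto the part on which \<open>a\<close> is invertible.\<close>

lemma drazin_spectral_idempotent: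
  assumes a: "a \<in> carrier G" and d: "is_drazin a k x"
  shows "a \<otimes> x \<otimes> (a \<otimes> x) = a \<otimes> x"
    and "a [^] (j + 1) \<otimes> x [^] ((j::nat) + 1) = a \<otimes> x"
    and "x [^] (j + 1) \<otimes> a [^] (j + 1) = a \<otimes> x"
    and "a \<otimes> x \<otimes> a [^] k = a [^] k"
    and "a [^] k \<otimes> (a \<otimes> x) = a [^] k"
proof -
  note D = is_drazinD[OF d]
  note x = D(1)
  show idem: "a \<otimes> x \<otimes> (a \<otimes> x) = a \<otimes> x" using a x D(2) by (simp add: m_assoc)
  have pow: "(a \<otimes> x) [^] (j + 1) = a \<otimes> x" for j :: nat
  proof (induction j)
    case (Suc j)
    have "(a \<otimes> x) [^] (Suc j + 1) = (a \<otimes> x) [^] (j + 1) \<otimes> (a \<otimes> x)" by simp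
    then show ?case by (simp only: Suc.IH idem)
  qed (use a x in simp)
  show "a [^] (j + 1) \<otimes> x [^] (j + 1) = a \<otimes> x"
    using pow_mult_distrib[OF D(3) a x, of "j + 1"] by (simp only: pow)
  show "x [^] (j + 1) \<otimes> a [^] (j + 1) = a \<otimes> x"
    using pow_mult_distrib[OF D(3)[symmetric] x a, of "j + 1"]
    by (simp only: pow D(3)[symmetric])
  show "a [^] k \<otimes> (a \<otimes> x) = a [^] k" using D(4) a x by (simp add: m_assoc)
  have "a [^] k \<otimes> x = x \<otimes> a [^] k"
  proof (induction k)
    case (Suc k)
    have "a [^] Suc k \<otimes> x = a [^] k \<otimes> x \<otimes> a" using a x D(3) by (simp add: m_assoc)
    also have "\<dots> = x \<otimes> a [^] Suc k" using a x Suc by (simp add: m_assoc)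
    finally show ?case .
  qed (use x in simp)
  then have "a \<otimes> x \<otimes> a [^] k = a \<otimes> a [^] k \<otimes> x" using a x by (simp add: m_assoc)
  also have "\<dots> = a [^] (k + 1) \<otimes> x" using a nat_pow_comm[of a 1 k] by simp
  finally show "a \<otimes> x \<otimes> a [^] k = a [^] k" by (simp only: D(4))
qed

text \<open>Each spectral idempotent factors through \<open>a\<^sup>k\<close>, on which the other one acts as the
  identity. So the two idempotents absorb each other and are equal.\<close>

lemma drazin_unique:
  assumes a: "a \<in> carrier G" and dx: "is_drazin a k x" and dy: "is_drazin a k y"
  shows "x = y"
proof -
  note x = is_drazinD(1)[OF dx] and y = is_drazinD(1)[OF dy]
  have abs: "a \<otimes> v \<otimes> (a \<otimes> u) = a \<otimes> u" "a \<otimes> u \<otimes> (a \<otimes> v) = a \<otimes> u"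
    if du: "is_drazin a k u" and dv: "is_drazin a k v" for u v
  proof -
    note u = is_drazinD(1)[OF du] and v = is_drazinD(1)[OF dv]
    note U = drazin_spectral_idempotent[OF a du] and V = drazin_spectral_idempotent[OF a dv]
    have "a \<otimes> v \<otimes> (a \<otimes> u) = a \<otimes> v \<otimes> a [^] k \<otimes> (a \<otimes> u [^] (k + 1))"
      using a u v U(2)[of k, symmetric] by (simp add: m_assoc)
    also have "\<dots> = a \<otimes> u" unfolding V(4) using a u v U(2)[of k] by (simp add: m_assoc)
    finally show "a \<otimes> v \<otimes> (a \<otimes> u) = a \<otimes> u" .
    have "a [^] (k + 1) \<otimes> (a \<otimes> v) = a \<otimes> (a [^] k \<otimes> (a \<otimes> v))"
      using a v nat_pow_comm[of a 1 k] by (simp add: m_assoc[symmetric])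
    also have "\<dots> = a [^] (k + 1)" unfolding V(5) using a nat_pow_comm[of a 1 k] by simp
    finally have *: "a [^] (k + 1) \<otimes> (a \<otimes> v) = a [^] (k + 1)" .
    have "a \<otimes> u \<otimes> (a \<otimes> v) = u [^] (k + 1) \<otimes> (a [^] (k + 1) \<otimes> (a \<otimes> v))"
      using a u v U(3)[of k, symmetric] by (simp only: m_assoc m_closed nat_pow_closed)
    also have "\<dots> = a \<otimes> u" unfolding * by (rule U(3))
    finally show "a \<otimes> u \<otimes> (a \<otimes> v) = a \<otimes> u" .
  qed
  have e: "a \<otimes> x = a \<otimes> y" using abs(1)[OF dx dy] abs(2)[OF dy dx] by simp
  have "x = x \<otimes> a \<otimes> x" using is_drazinD(2)[OF dx] by simp
  also have "\<dots> = a \<otimes> y \<otimes> x" by (simp only: is_drazinD(3)[OF dx, symmetric] e)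
  also have "\<dots> = y \<otimes> (a \<otimes> x)" using a x y is_drazinD(3)[OF dy] by (simp add: m_assoc)
  also have "\<dots> = y \<otimes> a \<otimes> y" using a y by (simp add: e m_assoc)
  also have "\<dots> = y" by (rule is_drazinD(2)[OF dy])
  finally show ?thesis .
qed

section \<open>Characterisations of the DMP inverse\<close>

text \<open>The equation makes \<open>x = a\<^sup>k x\<^sup>k\<^sup>+\<^sup>1\<close>, so \<open>x\<close> lies in the range of \<open>a\<^sup>k\<close>, which the spectral
  idempotent fixes.\<close>

lemma mult_square_eq_imp_spectral_fixed:
  assumes a: "a \<in> carrier G" and d: "is_drazin a k d" and x: "x \<in> carrier G"
    and eq: "a \<otimes> x [^] (2::nat) = x"
  shows "a \<otimes> d \<otimes> x = x"
proof -
  note dc = is_drazinD(1)[OF d]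
  have eq': "a \<otimes> (x \<otimes> x) = x" using eq x by (simp add: numeral_2_eq_2)
  have it: "a [^] j \<otimes> (x [^] j \<otimes> x) = x" for j :: nat
  proof (induction j)
    case (Suc j)
    have c: "x [^] j \<otimes> x = x \<otimes> x [^] j" using x nat_pow_comm[of x 1 j] by simp
    have c2: "x [^] j \<otimes> x \<otimes> x = x \<otimes> x \<otimes> x [^] j"
      using x by (simp only: c m_assoc nat_pow_closed)
    have "a [^] Suc j \<otimes> (x [^] Suc j \<otimes> x) = a [^] j \<otimes> (a \<otimes> (x \<otimes> x) \<otimes> x [^] j)"
      unfolding nat_pow_Suc c2 using a x by (simp only: m_assoc m_closed nat_pow_closed)
    also have "\<dots> = a [^] j \<otimes> (x [^] j \<otimes> x)" by (simp only: eq' c)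
    finally show ?case by (simp only: Suc.IH)
  qed (use a x in simp)
  have "a \<otimes> d \<otimes> x = a \<otimes> d \<otimes> (a [^] k \<otimes> (x [^] k \<otimes> x))" by (simp only: it)
  also have "\<dots> = a \<otimes> d \<otimes> a [^] k \<otimes> (x [^] k \<otimes> x)"
    using a x dc by (simp only: m_assoc m_closed nat_pow_closed)
  also have "\<dots> = x" by (simp only: drazin_spectral_idempotent(4)[OF a d] it)
  finally show ?thesis .
qed

text \<open>The element \<open>m\<close> stands for the Minkowski inverse. It enters through \<open>a m a = a\<close>, which gives
  \<open>a m e = e\<close> for the spectral idempotent \<open>e = a d\<close>.\<close>

context
  fixes a d m :: 'a and k :: nat
  assumes a: "a \<in> carrier G" and d: "is_drazin a k d"
    and m: "m \<in> carrier G" and ama: "a \<otimes> m \<otimes> a = a"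
begin

private lemma cl: "d \<in> carrier G" "a \<in> carrier G" "m \<in> carrier G"
  using is_drazinD(1)[OF d] a m by auto

private lemma da: "d \<otimes> a = a \<otimes> d" using is_drazinD(3)[OF d] by simp
private lemma da': "t \<in> carrier G \<Longrightarrow> d \<otimes> (a \<otimes> t) = a \<otimes> (d \<otimes> t)"
  using cl da by (simp add: m_assoc[symmetric])
private lemmas E = drazin_spectral_idempotent[OF a d]

lemma mult_dmp: "a \<otimes> (d \<otimes> a \<otimes> m) = a [^] (2::nat) \<otimes> d \<otimes> m"
  using cl by (simp add: numeral_2_eq_2 m_assoc da')

lemma inner_inverse_absorbs: "a \<otimes> m \<otimes> (a \<otimes> d) = a \<otimes> d"
  using cl ama by (simp add: m_assoc[symmetric])

lemma mult_dmp_square: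
  "a \<otimes> (d \<otimes> a \<otimes> m) [^] (2::nat) = d \<otimes> a \<otimes> m"
proof -
  have "a \<otimes> (d \<otimes> a \<otimes> m) [^] (2::nat) = a \<otimes> d \<otimes> (a \<otimes> m \<otimes> (a \<otimes> d)) \<otimes> m"
    using cl by (simp add: numeral_2_eq_2 m_assoc da da')
  also have "\<dots> = d \<otimes> a \<otimes> m" unfolding inner_inverse_absorbs E(1) da ..
  finally show ?thesis .
qed

lemma dmp_iff_mult_a:
  assumes x: "x \<in> carrier G"
  shows "x = d \<otimes> a \<otimes> m \<longleftrightarrow>
    a \<otimes> x [^] (2::nat) = x \<and> a \<otimes> x = a [^] (2::nat) \<otimes> d \<otimes> m"
proof
  assume "x = d \<otimes> a \<otimes> m"
  then show "a \<otimes> x [^] (2::nat) = x \<and> a \<otimes> x = a [^] (2::nat) \<otimes> d \<otimes> m"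
    using mult_dmp mult_dmp_square by simp
next
  assume "a \<otimes> x [^] (2::nat) = x \<and> a \<otimes> x = a [^] (2::nat) \<otimes> d \<otimes> m"
  then have sq: "a \<otimes> x [^] (2::nat) = x" and ax: "a \<otimes> x = a \<otimes> (d \<otimes> a \<otimes> m)"
    by (simp_all add: mult_dmp)
  have "x = d \<otimes> (a \<otimes> x)"
    using mult_square_eq_imp_spectral_fixed[OF a d x sq] x cl by (simp add: m_assoc[symmetric] da)
  also have "\<dots> = d \<otimes> a \<otimes> d \<otimes> a \<otimes> m"
    unfolding ax using cl by (simp add: m_assoc)
  finally show "x = d \<otimes> a \<otimes> m" by (simp only: is_drazinD(2)[OF d])
qed

text \<open>Here \<open>k\<close> may be \<open>0\<close>, so the spectral idempotent is written as \<open>d\<^sup>k\<^sup>+\<^sup>1 a a\<^sup>k\<close>, which exposes a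
  factor \<open>a\<^sup>k\<close> on the right in all cases.\<close>

lemma dmp_iff_mult_pow:
  assumes x: "x \<in> carrier G"
  shows "x = d \<otimes> a \<otimes> m \<longleftrightarrow>
    a \<otimes> x [^] (2::nat) = x \<and> a [^] k \<otimes> x = a [^] k \<otimes> m"
proof
  assume *: "x = d \<otimes> a \<otimes> m"
  have "a [^] k \<otimes> x = a [^] k \<otimes> (a \<otimes> d) \<otimes> m"
    unfolding * da using cl by (simp add: m_assoc)
  then show "a \<otimes> x [^] (2::nat) = x \<and> a [^] k \<otimes> x = a [^] k \<otimes> m"
    using * mult_dmp_square by (simp add: E(5))
next
  assume "a \<otimes> x [^] (2::nat) = x \<and> a [^] k \<otimes> x = a [^] k \<otimes> m"
  then have sq: "a \<otimes> x [^] (2::nat) = x" and eq: "a [^] k \<otimes> x = a [^] k \<otimes> m" by auto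
  have e: "a \<otimes> d = d [^] (k + 1) \<otimes> a \<otimes> a [^] k"
    using E(3)[of k] cl nat_pow_comm[of a 1 k] by (simp add: m_assoc)
  have "x = d [^] (k + 1) \<otimes> a \<otimes> (a [^] k \<otimes> x)"
    using mult_square_eq_imp_spectral_fixed[OF a d x sq, symmetric] x cl unfolding e
    by (simp only: m_assoc m_closed nat_pow_closed)
  also have "\<dots> = a \<otimes> d \<otimes> m"
    unfolding eq e using cl by (simp only: m_assoc m_closed nat_pow_closed)
  finally show "x = d \<otimes> a \<otimes> m" by (simp only: da)
qed

text \<open>For matrices, two elements that are right multiples of each other have the same range, and two that are
  left multiples of each other have the same null space. The factorisations therefore identify the
  range of \<open>p\<close> with that of \<open>a\<^sup>k\<close> and its null space with that of \<open>d m\<close>.\<close>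

lemma dmp_projection:
  defines "p \<equiv> a [^] (2::nat) \<otimes> d \<otimes> m"
  shows "p \<otimes> p = p"
    and "p \<otimes> a [^] k = a [^] k" and "p = a [^] k \<otimes> (a \<otimes> d [^] (k + 1) \<otimes> a \<otimes> m)"
    and "p = a [^] (2::nat) \<otimes> (d \<otimes> m)" and "d \<otimes> m = d [^] (2::nat) \<otimes> p"
proof -
  have p: "p = a \<otimes> d \<otimes> (a \<otimes> m)"
    unfolding p_def mult_dmp[symmetric] using cl by (simp add: m_assoc)
  have pe: "p \<otimes> (a \<otimes> d) = a \<otimes> d"
    unfolding p using cl inner_inverse_absorbs E(1) by (simp add: m_assoc)
  have "p \<otimes> p = p \<otimes> (a \<otimes> d) \<otimes> (a \<otimes> m)"
    using cl by (simp add: p m_assoc)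
  also have "\<dots> = p" by (simp only: pe) (simp only: p)
  finally show "p \<otimes> p = p" .
  have pc: "p \<in> carrier G" using cl by (simp add: p)
  have "p \<otimes> a [^] k = p \<otimes> (a \<otimes> d) \<otimes> a [^] k"
    using cl pc E(4) by (simp only: m_assoc m_closed nat_pow_closed)
  then show "p \<otimes> a [^] k = a [^] k" by (simp only: pe E(4))
  show "p = a [^] k \<otimes> (a \<otimes> d [^] (k + 1) \<otimes> a \<otimes> m)"
    unfolding p E(2)[of k, symmetric] using cl by (simp add: m_assoc)
  show "p = a [^] (2::nat) \<otimes> (d \<otimes> m)" unfolding p_def using cl by (simp add: m_assoc)
  have "d [^] (2::nat) \<otimes> p = d \<otimes> (a \<otimes> d \<otimes> (a \<otimes> d)) \<otimes> m"
    unfolding p using cl by (simp add: m_assoc numeral_2_eq_2 da da')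
  also have "\<dots> = d \<otimes> a \<otimes> d \<otimes> m" unfolding E(1) using cl by (simp add: m_assoc)
  finally show "d \<otimes> m = d [^] (2::nat) \<otimes> p" by (simp only: is_drazinD(2)[OF d])
qed

end
end

section \<open>Moore-Penrose inverses in a monoid with involution\<close>

locale involutive_monoid = monoid +
  fixes adj :: "'a \<Rightarrow> 'a"
  assumes adj_closed [simp, intro]: "a \<in> carrier G \<Longrightarrow> adj a \<in> carrier G"
    and adj_adj [simp]: "a \<in> carrier G \<Longrightarrow> adj (adj a) = a"
    and adj_mult: "\<lbrakk>a \<in> carrier G; b \<in> carrier G\<rbrakk> \<Longrightarrow> adj (a \<otimes> b) = adj b \<otimes> adj a"
begin

definition is_mp_inverse :: "'a \<Rightarrow> 'a \<Rightarrow> bool" where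
  "is_mp_inverse a x \<longleftrightarrow> x \<in> carrier G \<and> a \<otimes> x \<otimes> a = a \<and> x \<otimes> a \<otimes> x = x \<and>
     adj (a \<otimes> x) = a \<otimes> x \<and> adj (x \<otimes> a) = x \<otimes> a"

lemma mp_inverse_unique:
  assumes a: "a \<in> carrier G" and X: "is_mp_inverse a x" and Y: "is_mp_inverse a y"
  shows "x = y"
proof -
  have x: "x \<in> carrier G" "a \<otimes> x \<otimes> a = a" "x \<otimes> a \<otimes> x = x"
      "adj (a \<otimes> x) = a \<otimes> x" "adj (x \<otimes> a) = x \<otimes> a"
    and y: "y \<in> carrier G" "a \<otimes> y \<otimes> a = a" "y \<otimes> a \<otimes> y = y"
      "adj (a \<otimes> y) = a \<otimes> y" "adj (y \<otimes> a) = y \<otimes> a"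
    using X Y by (auto simp: is_mp_inverse_def)
  have "a \<otimes> x = adj (a \<otimes> y \<otimes> a \<otimes> x)" using x y by simp
  also have "\<dots> = a \<otimes> x \<otimes> (a \<otimes> y)"
    using a x(1) y(1) adj_mult[of "a \<otimes> y" "a \<otimes> x"]
    by (simp only: m_assoc[symmetric] m_closed x(4) y(4))
  also have "\<dots> = a \<otimes> y" using a x y by (simp add: m_assoc[symmetric])
  finally have l: "a \<otimes> x = a \<otimes> y" .
  have "x \<otimes> a = adj (x \<otimes> (a \<otimes> y \<otimes> a))" using x y by simp
  also have "\<dots> = y \<otimes> a \<otimes> (x \<otimes> a)"
    using a x(1) y(1) adj_mult[of "x \<otimes> a" "y \<otimes> a"]
    by (simp only: m_assoc m_closed) (simp only: x(5) y(5) m_assoc[symmetric] m_closed)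
  also have "\<dots> = y \<otimes> (a \<otimes> x \<otimes> a)" using a x(1) y(1) by (simp add: m_assoc)
  finally have r: "x \<otimes> a = y \<otimes> a" by (simp only: x(2))
  have "x = x \<otimes> a \<otimes> x" using x by simp
  also have "\<dots> = y \<otimes> a \<otimes> y" unfolding r using a x(1) y(1) l by (simp add: m_assoc)
  finally show ?thesis using y by simp
qed

text \<open>With \<open>b = adj a\<close>, the element \<open>x = b y = z b\<close> satisfies \<open>b a x = b = x a b\<close>. Reading this under the
  involution gives \<open>adj (a x) = adj (a x) (a x)\<close>, whose right-hand side is self-adjoint, and likewise for
  \<open>x a\<close>. For the ordinary adjoint of complex matrices, whose form is definite, such \<open>y\<close> and \<open>z\<close> always
  exist; for an indefinite form they are a genuine condition on \<open>a\<close>.\<close>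

lemma mp_inverse_exists:
  assumes a: "a \<in> carrier G" and y: "y \<in> carrier G" and z: "z \<in> carrier G"
    and bab_y: "adj a \<otimes> a \<otimes> adj a \<otimes> y = adj a" and z_bab: "z \<otimes> (adj a \<otimes> a \<otimes> adj a) = adj a"
  shows "is_mp_inverse a (adj a \<otimes> y)"
proof -
  define b where "b = adj a"
  define x where "x = b \<otimes> y"
  have b: "b \<in> carrier G" and ab: "adj b = a" using a by (simp_all add: b_def)
  note cl = a b y z
  have x: "x \<in> carrier G" using cl by (simp add: x_def)
  have bax: "b \<otimes> a \<otimes> x = b" using bab_y cl by (simp add: x_def b_def m_assoc)
  have "x = z \<otimes> (b \<otimes> a \<otimes> b) \<otimes> y" using z_bab by (simp add: x_def b_def)
  also have "\<dots> = z \<otimes> (b \<otimes> a \<otimes> x)" using cl by (simp add: x_def m_assoc)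
  finally have xz: "x = z \<otimes> b" by (simp only: bax)
  have xab: "x \<otimes> a \<otimes> b = b" using z_bab cl unfolding xz by (simp add: b_def m_assoc)
  have xax: "x \<otimes> a \<otimes> x = x"
  proof -
    have "x \<otimes> a \<otimes> x = z \<otimes> b \<otimes> a \<otimes> x" by (simp only: xz)
    also have "\<dots> = z \<otimes> (b \<otimes> a \<otimes> x)" using cl x by (simp add: m_assoc)
    also have "\<dots> = x" by (simp only: bax) (simp only: xz)
    finally show ?thesis .
  qed
  have "adj (a \<otimes> x) \<otimes> (a \<otimes> x) = adj x \<otimes> (b \<otimes> a \<otimes> x)"
    using cl x by (simp add: adj_mult b_def m_assoc)
  then have 1: "adj (a \<otimes> x) = adj (a \<otimes> x) \<otimes> (a \<otimes> x)"
    using cl x by (simp only: bax) (simp add: adj_mult b_def)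
  then have sa: "adj (a \<otimes> x) = a \<otimes> x"
    using a x by (metis adj_adj adj_closed adj_mult m_closed)
  have "x \<otimes> a \<otimes> adj (x \<otimes> a) = x \<otimes> a \<otimes> b \<otimes> adj x"
    using cl x by (simp add: adj_mult b_def m_assoc)
  then have 2: "adj (x \<otimes> a) = x \<otimes> a \<otimes> adj (x \<otimes> a)"
    using cl x by (simp only: xab) (simp add: adj_mult b_def)
  then have sb: "adj (x \<otimes> a) = x \<otimes> a"
    using a x by (metis adj_adj adj_closed adj_mult m_closed)
  have "a \<otimes> x \<otimes> a = adj (b \<otimes> (a \<otimes> x))"
    using cl x sa by (simp add: adj_mult[of b "a \<otimes> x"] ab)
  also have "\<dots> = a" using cl x bax by (simp add: m_assoc ab)
  finally have "a \<otimes> x \<otimes> a = a" .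
  with x xax sa sb show ?thesis by (simp add: is_mp_inverse_def x_def b_def)
qed

end

section \<open>Rank, range and null space of square matrices\<close>

lemma mat_vec_unit_col:
  fixes B :: "'a :: semiring_1 mat"
  assumes "B \<in> carrier_mat nr n" "j < n"
  shows "B *\<^sub>v unit_vec n j = col B j"
  using assms by (intro eq_vecI) auto

context vec_space begin

lemma dim_col_space_eq_rank: "vectorspace.dim class_ring (vs (col_space A)) = rank A"
  by (simp add: rank_def col_space_def)

lemma subspace_col_space:
  assumes "A \<in> carrier_mat n nc"
  shows "VectorSpace.subspace class_ring (col_space A) V"
  unfolding col_space_def using assms cols_dim[of A] by (intro span_is_subspace) auto

lemma linear_map_mult_mat_vec:
  assumes A: "A \<in> carrier_mat n n"
  shows "linear_map class_ring V V (\<lambda>v. A *\<^sub>v v)"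
  using A by unfold_locales
    (auto simp: LinearCombinations.module_hom_def mult_add_distrib_mat_vec mult_mat_vec)

lemma ker_mult_mat_vec:
  assumes A: "A \<in> carrier_mat n n"
  shows "mod_hom.ker V V (\<lambda>v. A *\<^sub>v v) = mat_kernel A"
proof -
  interpret T: linear_map class_ring V V "\<lambda>v. A *\<^sub>v v"
    by (rule linear_map_mult_mat_vec[OF A])
  show ?thesis using A by (auto simp: T.ker_def mat_kernel[OF A])
qed

lemma subspace_mat_kernel:
  assumes A: "A \<in> carrier_mat n n"
  shows "VectorSpace.subspace class_ring (mat_kernel A) V"
proof -
  interpret T: linear_map class_ring V V "\<lambda>v. A *\<^sub>v v"
    by (rule linear_map_mult_mat_vec[OF A])
  show ?thesis using T.kerT_is_subspace by (simp add: ker_mult_mat_vec[OF A])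
qed

lemma rank_plus_dim_kernel:
  assumes A: "A \<in> carrier_mat n n"
  shows "rank A + vectorspace.dim class_ring (vs (mat_kernel A)) = n"
proof -
  interpret T: linear_map class_ring V V "\<lambda>v. A *\<^sub>v v"
    by (rule linear_map_mult_mat_vec[OF A])
  have "T.im = col_space A"
    using A by (auto simp: T.im_def col_space_eq[OF A])
  then show ?thesis
    using T.rank_nullity by (simp add: ker_mult_mat_vec[OF A] dim_col_space_eq_rank dim_is_n)
qed

lemma rank_cong_kernel:
  assumes "A \<in> carrier_mat n n" "B \<in> carrier_mat n n" "mat_kernel A = mat_kernel B"
  shows "rank A = rank B"
  using rank_plus_dim_kernel[OF assms(1)] rank_plus_dim_kernel[OF assms(2)] assms(3) by simp

lemma col_space_mult_subset:
  assumes A: "A \<in> carrier_mat n n" and B: "B \<in> carrier_mat n n"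
  shows "col_space (A * B) \<subseteq> col_space A"
  using A B by (auto simp: col_space_eq[OF A] col_space_eq[OF mult_carrier_mat[OF A B]])

text \<open>A basis of the smaller space is independent in the larger one; if the dimensions agree it spans
  that space too.\<close>

lemma rank_mono_col_space:
  assumes A: "A \<in> carrier_mat n n" and B: "B \<in> carrier_mat n n" and sub: "col_space A \<subseteq> col_space B"
  shows "rank A \<le> rank B" and "rank A = rank B \<Longrightarrow> col_space A = col_space B"
proof -
  let ?W = "vs (col_space B)"
  have fA: "vectorspace.fin_dim class_ring (vs (col_space A))"
    and fB: "vectorspace.fin_dim class_ring ?W"
    using fin_dim_span_cols A B by (auto simp: col_space_def)
  interpret W: vectorspace class_ring ?W
    by (rule subspace_is_vs[OF subspace_col_space[OF B]])
  interpret U: vectorspace class_ring "vs (col_space A)"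
    by (rule subspace_is_vs[OF subspace_col_space[OF A]])
  have s: "VectorSpace.subspace class_ring (col_space A) ?W"
    by (rule nested_subspaces[OF subspace_col_space[OF B] subspace_col_space[OF A] sub])
  show "rank A \<le> rank B"
    using W.subspace_dim[OF s fB] fA by (simp add: dim_col_space_eq_rank)
  assume eq: "rank A = rank B"
  show "col_space A = col_space B" 
  proof -
    obtain b where b: "finite b" "U.basis b"
      using U.finite_basis_exists[OF fA] by auto
    then have li: "module.lin_indpt class_ring (vs (col_space A)) b"
      and sp: "LinearCombinations.module.span class_ring (vs (col_space A)) b = col_space A"
      and bA: "b \<subseteq> col_space A"
      by (auto simp: U.basis_def)
    have sA: "submodule class_ring (col_space A) V" "submodule class_ring (col_space B) V"
      using subspace_col_space A B by (auto simp: subspace_def)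
    have liW: "module.lin_indpt class_ring ?W b"
      and spW: "LinearCombinations.module.span class_ring ?W b = col_space A"
      using li sp span_li_not_depend[OF bA sA(1)] span_li_not_depend[OF order.trans[OF bA sub] sA(2)]
      by auto
    have "W.basis b"
      using W.dim_li_is_basis[OF fB b(1) _ liW] bA sub eq U.dim_basis[OF b]
      by (simp add: dim_col_space_eq_rank)
    then show ?thesis using spW by (simp add: W.basis_def)
  qed
qed


text \<open>Solve for each column separately and collect the solutions as the columns of \<open>Y\<close>.\<close>

lemma factor_through_col_space:
  assumes A: "A \<in> carrier_mat n n" and B: "B \<in> carrier_mat n n"
    and sub: "col_space B \<subseteq> col_space A"
  obtains Y where "Y \<in> carrier_mat n n" "A * Y = B"
proof -
  have "\<exists>y \<in> carrier_vec n. A *\<^sub>v y = col B j" if j: "j < n" for j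
  proof -
    have "B *\<^sub>v unit_vec n j \<in> col_space B"
      using B by (auto simp: col_space_eq[OF B])
    moreover have "B *\<^sub>v unit_vec n j = col B j" by (rule mat_vec_unit_col[OF B j])
    ultimately show ?thesis using sub A unfolding col_space_eq[OF A] by auto
  qed
  then obtain y where y: "\<And>j. j < n \<Longrightarrow> y j \<in> carrier_vec n \<and> A *\<^sub>v y j = col B j"
    by metis
  define Y where "Y = mat_of_cols n (map y [0..<n])"
  have Y: "Y \<in> carrier_mat n n"
    using mat_of_cols_carrier(1)[of n "map y [0..<n]"] by (simp add: Y_def)
  have "col Y j = y j" if "j < n" for j
    using that y[OF that] by (simp add: Y_def)
  then have "col (A * Y) j = col B j" if "j < n" for j
    using that y[OF that] by (simp only: col_mult2[OF A Y that])
  then have "A * Y = B"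
    using A B Y by (intro mat_col_eqI) auto
  with Y that show ?thesis by blast
qed

lemma rank_mult_eq_imp_factor:
  assumes A: "A \<in> carrier_mat n n" and B: "B \<in> carrier_mat n n"
    and r: "rank (A * B) = rank A"
  obtains Y where "Y \<in> carrier_mat n n" "A * B * Y = A"
proof -
  have AB: "A * B \<in> carrier_mat n n" using A B by simp
  have "col_space (A * B) = col_space A"
    using rank_mono_col_space(2)[OF AB A col_space_mult_subset[OF A B] r] .
  then show ?thesis using factor_through_col_space[OF AB A] that by auto
qed

lemma rank_mult_le:
  assumes A: "A \<in> carrier_mat n n" and B: "B \<in> carrier_mat n n"
  shows "rank (A * B) \<le> rank A"
  using rank_mono_col_space(1)[OF _ A col_space_mult_subset[OF A B]] A B by simp

end

lemma mat_adjoint_carrier: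
  assumes "A \<in> carrier_mat n n" shows "mat_adjoint A \<in> carrier_mat n n"
  using assms by (auto simp: mat_adjoint_def)

lemma index_mat_adjoint:
  assumes "A \<in> carrier_mat n n" "i < n" "j < n"
  shows "mat_adjoint A $$ (i, j) = conjugate (A $$ (j, i))"
  using assms by (auto simp: mat_adjoint_def mat_of_rows_index)

lemma mat_adjoint_adjoint:
  assumes "A \<in> carrier_mat n n" shows "mat_adjoint (mat_adjoint A) = A"
  using assms mat_adjoint_carrier[OF assms] mat_adjoint_carrier[OF mat_adjoint_carrier[OF assms]]
  by (intro eq_matI) (auto simp: index_mat_adjoint[of _ n])

lemma mat_adjoint_mult:
  fixes A B :: "complex mat"
  assumes "A \<in> carrier_mat n n" "B \<in> carrier_mat n n"
  shows "mat_adjoint (A * B) = mat_adjoint B * mat_adjoint A"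
proof (rule eq_matI)
  note c = assms mat_adjoint_carrier[OF assms(1)] mat_adjoint_carrier[OF assms(2)]
  fix i j assume "i < dim_row (mat_adjoint B * mat_adjoint A)"
    "j < dim_col (mat_adjoint B * mat_adjoint A)"
  then have ij: "i < n" "j < n" using c by auto
  show "mat_adjoint (A * B) $$ (i, j) = (mat_adjoint B * mat_adjoint A) $$ (i, j)"
    using ij c by (simp add: index_mat_adjoint[of _ n] scalar_prod_def mult.commute)
qed (use assms mat_adjoint_carrier[OF assms(1)] mat_adjoint_carrier[OF assms(2)] 
      mat_adjoint_carrier[OF mult_carrier_mat[OF assms]] in auto)

lemma adjoint_mult_vec_index:
  fixes A :: "complex mat"
  assumes "A \<in> carrier_mat n n" "w \<in> carrier_vec n" "j < n"
  shows "(mat_adjoint A *\<^sub>v w) $ j = (\<Sum>i<n. w $ i * cnj (A $$ (i, j)))"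
  using assms mat_adjoint_carrier[OF assms(1)]
  by (auto simp: scalar_prod_def index_mat_adjoint[OF assms(1)] atLeast0LessThan mult.commute
      intro!: sum.cong)

text \<open>If \<open>A\<^sup>* A v = 0\<close> then \<open>\<langle>A v, A v\<rangle> = \<langle>A\<^sup>* A v, v\<rangle> = 0\<close>, and the standard form is definite. This is
  the one place where the ordinary adjoint, rather than the Minkowski adjoint, is essential.\<close>

lemma mat_kernel_adjoint_mult:
  fixes A :: "complex mat"
  assumes A: "A \<in> carrier_mat n n"
  shows "mat_kernel (mat_adjoint A * A) = mat_kernel A"
proof
  note A' = mat_adjoint_carrier[OF A]
  show "mat_kernel A \<subseteq> mat_kernel (mat_adjoint A * A)"
    by (rule mat_kernel_mult_subset[OF A A'])
  show "mat_kernel (mat_adjoint A * A) \<subseteq> mat_kernel A"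
  proof
    fix v assume "v \<in> mat_kernel (mat_adjoint A * A)"
    from mat_kernelD[OF mult_carrier_mat[OF A' A] this] A A'
    have v: "v \<in> carrier_vec n" and z: "mat_adjoint A *\<^sub>v (A *\<^sub>v v) = 0\<^sub>v n" by auto
    let ?w = "A *\<^sub>v v"
    have w: "?w \<in> carrier_vec n" using A v by simp
    have "?w \<bullet>c ?w = (mat_adjoint A *\<^sub>v ?w) \<bullet>c v"
    proof -
      have "?w \<bullet>c ?w = (\<Sum>i<n. \<Sum>j<n. ?w $ i * cnj (A $$ (i, j)) * cnj (v $ j))"
        using A v w by (simp add: scalar_prod_def sum_distrib_left mult.assoc atLeast0LessThan)
      also have "\<dots> = (\<Sum>j<n. \<Sum>i<n. ?w $ i * cnj (A $$ (i, j)) * cnj (v $ j))"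
        by (rule sum.swap)
      also have "\<dots> = (mat_adjoint A *\<^sub>v ?w) \<bullet>c v"
        using A A' v by (auto simp: scalar_prod_def adjoint_mult_vec_index[OF A w] sum_distrib_right atLeast0LessThan
          simp del: index_mult_mat_vec intro!: sum.cong)
      finally show ?thesis .
    qed
    also have "\<dots> = 0" using v z by simp
    finally have "?w = 0\<^sub>v n" using w conjugate_square_eq_0_vec by blast
    then show "v \<in> mat_kernel A" using A v by (auto intro: mat_kernelI)
  qed
qed

text \<open>As \<open>A\<close> and \<open>A\<^sup>* A\<close> have the same null space they have the same rank, so
  \<open>rank A = rank (A\<^sup>* A) \<le> rank A\<^sup>*\<close>; the reverse inequality is this one for \<open>A\<^sup>*\<close>.\<close>

lemma rank_mat_adjoint:
  fixes A :: "complex mat"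
  assumes A: "A \<in> carrier_mat n n"
  shows "vec_space.rank n (mat_adjoint A) = vec_space.rank n A"
proof -
  interpret vec_space "TYPE(complex)" n .
  have le: "rank B \<le> rank (mat_adjoint B)" if B: "B \<in> carrier_mat n n" for B :: "complex mat"
  proof -
    note B' = mat_adjoint_carrier[OF B]
    have "rank B = rank (mat_adjoint B * B)"
      using rank_cong_kernel[OF B mult_carrier_mat[OF B' B]] mat_kernel_adjoint_mult[OF B] by simp
    also have "\<dots> \<le> rank (mat_adjoint B)" by (rule rank_mult_le[OF B' B])
    finally show ?thesis .
  qed
  show ?thesis
    using le[OF A] le[OF mat_adjoint_carrier[OF A]] by (simp add: mat_adjoint_adjoint[OF A])
qed

text \<open>Taking adjoints turns a left factor into a right factor and keeps the ranks.\<close>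

lemma rank_mult_eq_imp_left_factor:
  fixes A B :: "complex mat"
  assumes A: "A \<in> carrier_mat n n" and B: "B \<in> carrier_mat n n"
    and r: "vec_space.rank n (B * A) = vec_space.rank n A"
  obtains Z where "Z \<in> carrier_mat n n" "Z * (B * A) = A"
proof -
  interpret vec_space "TYPE(complex)" n .
  note A' = mat_adjoint_carrier[OF A] and B' = mat_adjoint_carrier[OF B]
  have BA: "B * A \<in> carrier_mat n n" using A B by simp
  have "rank (mat_adjoint A * mat_adjoint B) = rank (mat_adjoint A)"
    using r by (simp add: mat_adjoint_mult[OF B A, symmetric] rank_mat_adjoint[OF A]
        rank_mat_adjoint[OF BA])
  then obtain Y where Y: "Y \<in> carrier_mat n n"
      and eq: "mat_adjoint A * mat_adjoint B * Y = mat_adjoint A"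
    using rank_mult_eq_imp_factor[OF A' B'] by blast
  have "A = mat_adjoint (mat_adjoint (B * A) * Y)"
    by (simp add: mat_adjoint_mult[OF B A] eq mat_adjoint_adjoint[OF A])
  also have "\<dots> = mat_adjoint Y * (B * A)"
    by (simp add: mat_adjoint_mult[OF mat_adjoint_carrier[OF BA] Y] mat_adjoint_adjoint[OF BA])
  finally show ?thesis using that[OF mat_adjoint_carrier[OF Y]] by simp
qed

section \<open>Existence of the Drazin inverse of a matrix\<close>

text \<open>The ranks of the powers are nonincreasing natural numbers, so they cannot strictly decrease for
  ever; hence the minimum that defines the index is taken over a nonempty set.\<close>

lemma rank_pow_mat_index:
  assumes A: "A \<in> carrier_mat n n"
  shows "vec_space.rank n (A ^\<^sub>m (mat_index A + 1)) = vec_space.rank n (A ^\<^sub>m mat_index A)"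
proof -
  interpret vec_space "TYPE(complex)" n .
  let ?r = "\<lambda>j. rank (A ^\<^sub>m j)"
  have "\<exists>j. ?r (j + 1) = ?r j"
  proof (rule ccontr)
    assume "\<nexists>j. ?r (j + 1) = ?r j"
    moreover have "?r (j + 1) \<le> ?r j" for j
      using rank_mult_le[OF pow_carrier_mat[OF A, of j] A] by simp
    ultimately have less: "?r (j + 1) < ?r j" for j by (simp add: less_le)
    have "?r j + j \<le> ?r 0" for j
    proof (induction j)
      case (Suc j)
      then show ?case using less[of j] by simp
    qed simp
    from this[of "?r 0 + 1"] show False by simp
  qed
  from LeastI_ex[OF this] show ?thesis using A by (simp add: mat_index_def)
qed

text \<open>Equality of the ranks of \<open>A\<^sup>k\<close> and \<open>A\<^sup>k\<^sup>+\<^sup>1\<close>, read as \<open>A\<^sup>k A\<close>, yields the right factor, and read as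
  \<open>A A\<^sup>k\<close> the left factor.\<close>

lemma drazin_inverse_is_drazin:
  assumes A: "A \<in> carrier_mat n n"
  shows "monoid.is_drazin (ring_mat TYPE(complex) n ()) A (mat_index A) (drazin_inverse A)"
proof -
  interpret R: semiring "ring_mat TYPE(complex) n ()" by (rule semiring_mat)
  interpret vec_space "TYPE(complex)" n .
  let ?k = "mat_index A"
  note pow = pow_mat_ring_pow[OF A, of _ "()", symmetric]
  have Ak: "A ^\<^sub>m ?k \<in> carrier_mat n n" by (rule pow_carrier_mat[OF A])
  have comm: "A * A ^\<^sub>m ?k = A ^\<^sub>m (?k + 1)"
    using R.nat_pow_comm[of A 1 ?k] A by (simp add: ring_mat_simps pow)
  obtain Y where Y: "Y \<in> carrier_mat n n" "A ^\<^sub>m (?k + 1) * Y = A ^\<^sub>m ?k"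
    using rank_mult_eq_imp_factor[OF Ak A] rank_pow_mat_index[OF A] by auto
  obtain Z where Z: "Z \<in> carrier_mat n n" "Z * A ^\<^sub>m (?k + 1) = A ^\<^sub>m ?k"
    using rank_mult_eq_imp_left_factor[OF Ak A] rank_pow_mat_index[OF A] unfolding comm by auto
  have ex: "\<exists>X. R.is_drazin A ?k X"
    using R.drazin_exists[of A Y Z ?k] A Y Z by (auto simp: ring_mat_simps pow)
  have "drazin_inverse A = (THE X. R.is_drazin A ?k X)"
    using A unfolding drazin_inverse_def R.is_drazin_def by (simp add: ring_mat_simps pow)
  moreover have "\<exists>!X. R.is_drazin A ?k X"
    using ex R.drazin_unique[of A ?k] A by (auto simp: ring_mat_simps)
  ultimately show ?thesis using theI' by metis
qed

section \<open>Existence of the Minkowski inverse\<close>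

lemma minkowski_metric_carrier: "minkowski_metric n \<in> carrier_mat n n"
  by (simp add: minkowski_metric_def)

lemma minkowski_metric_square: "minkowski_metric n * minkowski_metric n = 1\<^sub>m n"
proof (rule eq_matI)
  fix i j assume "i < dim_row (1\<^sub>m n :: complex mat)" "j < dim_col (1\<^sub>m n :: complex mat)"
  then have ij: "i < n" "j < n" by auto
  have "(minkowski_metric n * minkowski_metric n) $$ (i, j) =
      (\<Sum>l\<in>{0..<n}. minkowski_metric n $$ (i, l) * minkowski_metric n $$ (l, j))"
    using ij minkowski_metric_carrier[of n] by (simp add: scalar_prod_def)
  also have "\<dots> = (\<Sum>l\<in>{0..<n}. if l = i then (if i = j then 1 else 0) else 0)"
    using ij by (intro sum.cong) (auto simp: minkowski_metric_def)
  finally show "(minkowski_metric n * minkowski_metric n) $$ (i, j) = 1\<^sub>m n $$ (i, j)"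
    using ij by simp
qed (auto simp: minkowski_metric_def)

lemma mat_adjoint_minkowski_metric: "mat_adjoint (minkowski_metric n) = minkowski_metric n"
proof (rule eq_matI)
  fix i j
  assume "i < dim_row (minkowski_metric n)" "j < dim_col (minkowski_metric n)"
  then have ij: "i < n" "j < n" by (simp_all add: minkowski_metric_def)
  show "mat_adjoint (minkowski_metric n) $$ (i, j) = minkowski_metric n $$ (i, j)"
    unfolding index_mat_adjoint[OF minkowski_metric_carrier ij]
    using ij by (simp add: minkowski_metric_def)
qed (use minkowski_metric_carrier[of n] mat_adjoint_carrier[OF minkowski_metric_carrier[of n]]
      in auto)

lemma minkowski_adjoint_carrier:
  assumes "A \<in> carrier_mat n n" shows "minkowski_adjoint A \<in> carrier_mat n n"
  using assms mat_adjoint_carrier[OF assms] minkowski_metric_carrier[of n]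
  by (auto simp: minkowski_adjoint_def)

lemma minkowski_metric_cancel:
  assumes "B \<in> carrier_mat n n"
  shows "minkowski_metric n * (minkowski_metric n * B) = B"
  using assms minkowski_metric_carrier[of n]
  by (simp add: assoc_mult_mat[of _ n n _ n _ n, symmetric] minkowski_metric_square)

text \<open>Inner factors \<open>G G\<close> cancel because the metric \<open>G\<close> is a self-adjoint square root of the identity, so
  conjugation by \<open>G\<close> leaves the laws of the ordinary adjoint intact.\<close>

lemma minkowski_involutive_monoid:
  "involutive_monoid (ring_mat TYPE(complex) n ()) minkowski_adjoint"
proof -
  interpret R: semiring "ring_mat TYPE(complex) n ()" by (rule semiring_mat)
  note G = minkowski_metric_carrier[of n]
  show ?thesis
  proof (unfold_locales, unfold ring_mat_simps)
    fix A B :: "complex mat"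
    assume A: "A \<in> carrier_mat n n"
    note A' = mat_adjoint_carrier[OF A]
    show "minkowski_adjoint A \<in> carrier_mat n n" by (rule minkowski_adjoint_carrier[OF A])
    have "mat_adjoint (minkowski_metric n * mat_adjoint A * minkowski_metric n) =
        minkowski_metric n * (A * minkowski_metric n)"
      using G A A' by (simp add: mat_adjoint_mult[of _ n] mat_adjoint_minkowski_metric
          mat_adjoint_adjoint[OF A])
    then show "minkowski_adjoint (minkowski_adjoint A) = A"
      using A A' G by (simp add: minkowski_adjoint_def assoc_mult_mat[of _ n n _ n _ n]
          minkowski_metric_cancel minkowski_metric_square)
    assume B: "B \<in> carrier_mat n n"
    note B' = mat_adjoint_carrier[OF B]
    show "minkowski_adjoint (A * B) = minkowski_adjoint B * minkowski_adjoint A"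
      using A A' B B' G
      by (simp add: minkowski_adjoint_def mat_adjoint_mult[OF A B] assoc_mult_mat[of _ n n _ n _ n]
          minkowski_metric_cancel)
  qed
qed

text \<open>Multiplying by the invertible \<open>G\<close> on the left keeps the null space, and on the right the range.\<close>

lemma rank_minkowski_adjoint:
  assumes A: "A \<in> carrier_mat n n"
  shows "vec_space.rank n (minkowski_adjoint A) = vec_space.rank n A"
proof -
  interpret vec_space "TYPE(complex)" n .
  let ?G = "minkowski_metric n" and ?A' = "mat_adjoint A"
  note G = minkowski_metric_carrier[of n] and A' = mat_adjoint_carrier[OF A]
  have A'G: "?A' * ?G \<in> carrier_mat n n" and GA'G: "?G * (?A' * ?G) \<in> carrier_mat n n"
    using G A' by auto
  have "mat_kernel (?G * (?A' * ?G)) = mat_kernel (?A' * ?G)"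
    using mat_kernel_mult_subset[OF A'G G] mat_kernel_mult_subset[OF GA'G G]
    by (simp add: minkowski_metric_cancel[OF A'G])
  then have "rank (minkowski_adjoint A) = rank (?A' * ?G)"
    using rank_cong_kernel[OF GA'G A'G] A A' G
    by (simp add: minkowski_adjoint_def assoc_mult_mat[of _ n n _ n _ n])
  also have "\<dots> = rank ?A'"
  proof (rule antisym)
    show "rank (?A' * ?G) \<le> rank ?A'" by (rule rank_mult_le[OF A' G])
    show "rank ?A' \<le> rank (?A' * ?G)"
      using rank_mult_le[OF A'G G] A' G
      by (simp add: assoc_mult_mat[of _ n n _ n _ n] minkowski_metric_square)
  qed
  also have "\<dots> = rank A" by (rule rank_mat_adjoint[OF A])
  finally show ?thesis .
qed

text \<open>With \<open>B\<close> the Minkowski adjoint, \<open>rank (B A B) = rank A = rank B\<close>. The product \<open>B A B\<close> is a right multiple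
  of \<open>B\<close> and also a left multiple, so \<open>B\<close> can be recovered from it on either side.\<close>

lemma minkowski_inverse_is_mp_inverse:
  assumes A: "A \<in> carrier_mat n n"
    and r: "vec_space.rank n (minkowski_adjoint A * A * minkowski_adjoint A) = vec_space.rank n A"
  shows "involutive_monoid.is_mp_inverse (ring_mat TYPE(complex) n ()) minkowski_adjoint
    A (minkowski_inverse A)"
proof -
  interpret R: involutive_monoid "ring_mat TYPE(complex) n ()" minkowski_adjoint
    by (rule minkowski_involutive_monoid)
  interpret vec_space "TYPE(complex)" n .
  let ?B = "minkowski_adjoint A"
  have B: "?B \<in> carrier_mat n n" by (rule minkowski_adjoint_carrier[OF A])
  have BA: "?B * A \<in> carrier_mat n n" and AB: "A * ?B \<in> carrier_mat n n" using A B by auto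
  have assoc: "?B * A * ?B = ?B * (A * ?B)" using A B by simp
  note r' = r[folded rank_minkowski_adjoint[OF A]]
  obtain Y where Y: "Y \<in> carrier_mat n n" "?B * A * ?B * Y = ?B"
    using rank_mult_eq_imp_factor[OF B AB] r' unfolding assoc by blast
  obtain Z where Z: "Z \<in> carrier_mat n n" "Z * (?B * A * ?B) = ?B"
    using rank_mult_eq_imp_left_factor[OF B BA] r' by blast
  have ex: "\<exists>X. R.is_mp_inverse A X"
    using R.mp_inverse_exists[of A Y Z] A Y Z by (auto simp: ring_mat_simps)
  have "minkowski_inverse A = (THE X. R.is_mp_inverse A X)"
    using A unfolding minkowski_inverse_def R.is_mp_inverse_def by (simp add: ring_mat_simps)
  moreover have "\<exists>!X. R.is_mp_inverse A X"
    using ex R.mp_inverse_unique[of A] A by (auto simp: ring_mat_simps)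
  ultimately show ?thesis using theI' by metis
qed

section \<open>Idempotent matrices as projectors\<close>

text \<open>The decomposition \<open>v = P v + (v - P v)\<close> splits every vector into a part in the range and a part in the
  null space; it also shows that a matrix with the prescribed values on both is \<open>P\<close>.\<close>

lemma idempotent_projector:
  assumes P: "P \<in> carrier_mat n n" and idem: "P * P = P"
  shows "complementary_subspaces n (vec_space.col_space n P) (mat_kernel P)"
    and "projector n (vec_space.col_space n P) (mat_kernel P) = P"
proof -
  interpret vec_space "TYPE(complex)" n .
  have fixed: "P *\<^sub>v s = s" if "s \<in> col_space P" for s
  proof -
    from that obtain x where x: "x \<in> carrier_vec n" and s: "s = P *\<^sub>v x"
      using P by (auto simp: col_space_eq[OF P])
    have "P *\<^sub>v s = P * P *\<^sub>v x" unfolding s using P x by simp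
    then show ?thesis by (simp add: idem s)
  qed
  have in_range: "P *\<^sub>v v \<in> col_space P" if "v \<in> carrier_vec n" for v
    using that P by (auto simp: col_space_eq[OF P])
  have in_kernel: "v - P *\<^sub>v v \<in> mat_kernel P" if v: "v \<in> carrier_vec n" for v
  proof -
    have "P *\<^sub>v (v - P *\<^sub>v v) = P *\<^sub>v v - P *\<^sub>v (P *\<^sub>v v)"
      using P v by (simp add: mult_minus_distrib_mat_vec)
    then show ?thesis using P v fixed[OF in_range[OF v]] by (auto intro!: mat_kernelI)
  qed
  have decomp: "P *\<^sub>v v + (v - P *\<^sub>v v) = v" if "v \<in> carrier_vec n" for v
    using that P by (intro eq_vecI) auto
  have sub: "col_space P \<subseteq> carrier_vec n" "mat_kernel P \<subseteq> carrier_vec n"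
    using P by (auto simp: col_space_eq[OF P] mat_kernel[OF P])
  have zero: "0\<^sub>v n \<in> col_space P"
  proof -
    have "P *\<^sub>v 0\<^sub>v n = 0\<^sub>v n" using P by (intro eq_vecI) auto
    then show ?thesis using in_range[of "0\<^sub>v n"] by simp
  qed
  show "complementary_subspaces n (col_space P) (mat_kernel P)"
    unfolding complementary_subspaces_def
  proof (intro conjI)
    show "col_space P \<inter> mat_kernel P = {0\<^sub>v n}"
    proof (intro equalityI subsetI)
      fix v assume v: "v \<in> col_space P \<inter> mat_kernel P"
      then have "v = P *\<^sub>v v" using fixed by simp
      also have "\<dots> = 0\<^sub>v n" using v mat_kernelD(2)[OF P] by simp
      finally show "v \<in> {0\<^sub>v n}" by simp
    qed (use zero fixed[OF zero] P in \<open>auto intro!: mat_kernelI\<close>)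
    show "{s + t |s t. s \<in> col_space P \<and> t \<in> mat_kernel P} = carrier_vec n"
    proof
      show "{s + t |s t. s \<in> col_space P \<and> t \<in> mat_kernel P} \<subseteq> carrier_vec n"
        using sub by auto
      show "carrier_vec n \<subseteq> {s + t |s t. s \<in> col_space P \<and> t \<in> mat_kernel P}"
      proof
        fix v :: "complex vec" assume "v \<in> carrier_vec n"
        from decomp[OF this, symmetric] in_range[OF this] in_kernel[OF this]
        show "v \<in> {s + t |s t. s \<in> col_space P \<and> t \<in> mat_kernel P}" by blast
      qed
    qed
  qed (use subspace_col_space[OF P] subspace_mat_kernel[OF P] in auto)
  show "projector n (col_space P) (mat_kernel P) = P"
    unfolding projector_def
  proof (rule the_equality)
    show "P \<in> carrier_mat n n \<and> (\<forall>s\<in>col_space P. P *\<^sub>v s = s) \<and>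
        (\<forall>t\<in>mat_kernel P. P *\<^sub>v t = 0\<^sub>v n)"
      using P fixed mat_kernelD[OF P] by auto
  next
    fix Q
    assume Q: "Q \<in> carrier_mat n n \<and> (\<forall>s\<in>col_space P. Q *\<^sub>v s = s) \<and>
        (\<forall>t\<in>mat_kernel P. Q *\<^sub>v t = 0\<^sub>v n)"
    have "Q *\<^sub>v v = P *\<^sub>v v" if v: "v \<in> carrier_vec n" for v
    proof -
      have "Q *\<^sub>v v = Q *\<^sub>v (P *\<^sub>v v) + Q *\<^sub>v (v - P *\<^sub>v v)"
        using Q P v mult_add_distrib_mat_vec[of Q n n "P *\<^sub>v v" "v - P *\<^sub>v v"]
        by (simp add: decomp[OF v])
      also have "\<dots> = P *\<^sub>v v + 0\<^sub>v n" using Q in_range[OF v] in_kernel[OF v] by simp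
      also have "\<dots> = P *\<^sub>v v" using P v by simp
      finally show ?thesis .
    qed
    then have "col Q j = col P j" if "j < n" for j
      using that P Q mat_vec_unit_col[of Q n n j] mat_vec_unit_col[of P n n j] by simp
    then show "Q = P" using P Q by (intro mat_col_eqI) auto
  qed
qed

lemma col_space_eq_if_factors:
  fixes P Q :: "complex mat"
  assumes "P \<in> carrier_mat n n" "Q \<in> carrier_mat n n" "U \<in> carrier_mat n n" "W \<in> carrier_mat n n"
    and "P = Q * U" "Q = P * W"
  shows "vec_space.col_space n P = vec_space.col_space n Q"
proof -
  interpret vec_space "TYPE(complex)" n .
  show ?thesis using assms col_space_mult_subset by (metis subset_antisym)
qed

lemma mat_kernel_eq_if_factors:
  fixes P Q :: "complex mat"
  assumes "P \<in> carrier_mat n n" "Q \<in> carrier_mat n n" "U \<in> carrier_mat n n" "W \<in> carrier_mat n n"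
    and "P = U * Q" "Q = W * P"
  shows "mat_kernel P = mat_kernel Q"
  using assms mat_kernel_mult_subset by (metis subset_antisym)

section \<open>Equivalent characterisations of the Minkowski DMP inverse\<close>

theorem theorem4p2:
  fixes A X :: "complex mat" and n k :: nat
  assumes "n \<ge> 1"
    and "A \<in> carrier_mat n n"
    and "mat_index A = k"
    and "vec_space.rank n (minkowski_adjoint A * A * minkowski_adjoint A) = vec_space.rank n A"
    and "X \<in> carrier_mat n n"
  shows
    "complementary_subspaces n
       (vec_space.col_space n (A ^\<^sub>m k)) (mat_kernel (drazin_inverse A * minkowski_inverse A)) \<and>
     (X = m_DMP_inverse A \<longleftrightarrow>
        A * X ^\<^sub>m 2 = X \<and>
        A * X = A ^\<^sub>m 2 * drazin_inverse A * minkowski_inverse A) \<and>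
     (X = m_DMP_inverse A \<longleftrightarrow>
        A * X ^\<^sub>m 2 = X \<and>
        A * X = projector n
          (vec_space.col_space n (A ^\<^sub>m k)) (mat_kernel (drazin_inverse A * minkowski_inverse A))) \<and>
     (X = m_DMP_inverse A \<longleftrightarrow>
        A * X ^\<^sub>m 2 = X \<and>
        A ^\<^sub>m k * X = A ^\<^sub>m k * minkowski_inverse A)"
proof -
  interpret R: involutive_monoid "ring_mat TYPE(complex) n ()" minkowski_adjoint
    by (rule minkowski_involutive_monoid)
  note A = assms(2) and X = assms(5)
  let ?D = "drazin_inverse A" and ?M = "minkowski_inverse A"
  have d: "R.is_drazin A k ?D" using drazin_inverse_is_drazin[OF A] by (simp add: assms(3))
  have mp: "R.is_mp_inverse A ?M" by (rule minkowski_inverse_is_mp_inverse[OF A assms(4)])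
  have D: "?D \<in> carrier_mat n n" using d by (simp add: R.is_drazin_def ring_mat_simps)
  have M: "?M \<in> carrier_mat n n" and AMA: "A * ?M * A = A"
    using mp by (auto simp: R.is_mp_inverse_def ring_mat_simps)
  note pow = pow_mat_ring_pow[of _ n _ "()", symmetric]
  have facts: "A \<in> carrier (ring_mat TYPE(complex) n ())" "R.is_drazin A k ?D"
      "?M \<in> carrier (ring_mat TYPE(complex) n ())"
      "A \<otimes>\<^bsub>ring_mat TYPE(complex) n ()\<^esub> ?M \<otimes>\<^bsub>ring_mat TYPE(complex) n ()\<^esub> A = A"
    and carr: "X \<in> carrier (ring_mat TYPE(complex) n ())"
    using A d M AMA X by (simp_all add: ring_mat_simps)
  let ?P = "A ^\<^sub>m 2 * ?D * ?M"
  note simps = ring_mat_simps pow[OF A] pow[OF X] pow[OF D]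
  note P = R.dmp_projection[OF facts, unfolded simps]
  note c = A D M pow_carrier_mat[OF A] pow_carrier_mat[OF D]
  have Pc: "?P \<in> carrier_mat n n" and Ak: "A ^\<^sub>m k \<in> carrier_mat n n"
    and DM: "?D * ?M \<in> carrier_mat n n"
    and U: "A * ?D ^\<^sub>m (k + 1) * A * ?M \<in> carrier_mat n n"
    using c by (auto intro!: mult_carrier_mat)
  have range: "vec_space.col_space n ?P = vec_space.col_space n (A ^\<^sub>m k)"
    by (rule col_space_eq_if_factors[OF Pc Ak U Ak P(3) P(2)[symmetric]])
  have kernel: "mat_kernel ?P = mat_kernel (?D * ?M)"
    by (rule mat_kernel_eq_if_factors[OF Pc DM _ _ P(4) P(5)]) (use c in auto)
  note proj = idempotent_projector[OF Pc P(1), unfolded range kernel]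
  show ?thesis
    using proj(1) R.dmp_iff_mult_a[OF facts carr, unfolded simps]
      R.dmp_iff_mult_pow[OF facts carr, unfolded simps]
    unfolding m_DMP_inverse_def proj(2) by blast
qed

end
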